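(* Let $k=(k_1,k_2)\in2\mathbb{Z}\times\mathbb{Z}$ with $k_1\ge1$ and $k_2\ge1$. Then $$\|E(\lambda,k)\|_k^2=\frac{c^*_{w^\lambda w_{\lambda^*}}(-(\lambda^*+\rho(k)\epsilon),k)}{\widetilde{c}_{w^\lambda w_{\lambda^*}}(\lambda^*+\rho(k)\epsilon,k)},\qquad\lambda\in P=\mathbb{Z}\epsilon.$$
   Context: Let $\rho(k)=\frac12(k_1+2k_2)$ and $\|f\|_k^2=(f,f)_k$ for the inner product on $\mathbb{C}[z^{\pm1}]$ $$(f,g)_k=\int_{S^1}\overline{f(z)}g(z)\delta_k(z)\frac{dz}{2\pi iz},\qquad\delta_k(z)=(2-z-z^{-1})^{k_1}(2-z^2-z^{-2})^{k_2}.$$ The non-symmetric Jacobi polynomials $E(n\epsilon,k)=E(n,k)=z^n+$ (combination of earlier monomials), $n\in\mathbb{Z}$, are obtained by Gram–Schmidt from the ordered basis $(1,z,z^{-1},z^2,z^{-2},\dots)$ with respect to $(\cdot,\cdot)_k$. $P=\mathbb{Z}\epsilon$, and $\mathbb{Z}_2=\{1,s\}$ acts by $s\epsilon=-\epsilon$. For $\lambda=n\epsilon$: $\lambda^*=|n|\epsilon$; $w^\lambda=1$ if $n\ge0$, $w^\lambda=s$ if $n<0$; $w_\lambda=s$ if $n=0$, $w_\lambda=1$ if $n\neq0$. Thus $w^\lambda w_{\lambda^*}=1$ for $n>0$ and $=s$ for $n\le0$. The generalized Harish-Chandra $c$-functions are, for $\lambda=t\epsilon$ ($t\in\mathbb{R}$):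 $$\widetilde{c}_1(\lambda,k)=\frac{\Gamma(t)\Gamma(t+\frac12)}{2^{k_1}\Gamma(t+\frac12k_1+\frac12)\Gamma(t+\frac12k_1+k_2)},\quad\widetilde{c}_s(\lambda,k)=\frac{\Gamma(t+\frac12)\Gamma(t+1)}{2^{k_1}\Gamma(t+\frac12k_1+\frac12)\Gamma(t+\frac12k_1+k_2+1)},$$ $$c^*_1(\lambda,k)=\frac{\Gamma(-t-\frac12k_1+\frac12)\Gamma(-t-\frac12k_1-k_2)}{2^{k_1}\Gamma(-t)\Gamma(-t+\frac12)},\quad c^*_s(\lambda,k)=\frac{\Gamma(-t-\frac12k_1+\frac12)\Gamma(-t-\frac12k_1-k_2+1)}{2^{k_1}\Gamma(-t+\frac12)\Gamma(-t+1)}.$$ *)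

theory Defs
  imports "HOL-Complex_Analysis.Complex_Analysis" "HOL-Library.Poly_Mapping"
begin

text \<open>
  Laurent polynomials in one variable over the complex numbers: the group algebra of the
  integers, a finitely supported function sending the exponent \<open>n\<close> to the coefficient of \<open>z\<^sup>n\<close>.
  The weight lattice is identified with the integers (\<open>n\<close> stands for \<open>n\<epsilon>\<close>), and its real
  span with the reals.
\<close>

type_synonym laurent_poly = "int \<Rightarrow>\<^sub>0 complex"

abbreviation (input) laurent_monom :: "int \<Rightarrow> laurent_poly" where
  "laurent_monom n \<equiv> Poly_Mapping.single n 1"

abbreviation (input) laurent_const :: "complex \<Rightarrow> laurent_poly" where
  "laurent_const c \<equiv> Poly_Mapping.single 0 c"

definition laurent_eval :: "laurent_poly \<Rightarrow> complex \<Rightarrow> complex" where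
  "laurent_eval f z = (\<Sum>n\<in>Poly_Mapping.keys f. Poly_Mapping.lookup f n * z powi n)"

type_synonym multiplicity = "int \<times> int"

definition rho :: "multiplicity \<Rightarrow> real" where
  "rho k = (real_of_int (fst k) + 2 * real_of_int (snd k)) / 2"

definition weight :: "multiplicity \<Rightarrow> complex \<Rightarrow> complex" where
  "weight k z = (2 - z - z powi (-1)) powi fst k * (2 - z powi 2 - z powi (-2)) powi snd k"

text \<open>Conjugate-linear in the first argument.\<close>

definition jacobi_inner :: "multiplicity \<Rightarrow> laurent_poly \<Rightarrow> laurent_poly \<Rightarrow> complex" where
  "jacobi_inner k f g =
     contour_integral (circlepath 0 1)
       (\<lambda>z. cnj (laurent_eval f z) * laurent_eval g z * weight k z / (2 * of_real pi * \<i> * z))"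

definition jacobi_norm_sq :: "multiplicity \<Rightarrow> laurent_poly \<Rightarrow> complex" where
  "jacobi_norm_sq k f = jacobi_inner k f f"

text \<open>
  The ordered monomial basis is \<open>1, z, z\<^sup>-\<^sup>1, z\<^sup>2, z\<^sup>-\<^sup>2, \<dots>\<close>; \<open>basis_exponent j\<close> is the exponent of
  its \<open>j\<close>-th element (counting from 0), and \<open>basis_position\<close> is the inverse enumeration.
\<close>

definition basis_exponent :: "nat \<Rightarrow> int" where
  "basis_exponent j = (if odd j then (int j + 1) div 2 else - (int j div 2))"

definition basis_position :: "int \<Rightarrow> nat" where
  "basis_position n = (if n > 0 then nat (2 * n - 1) else nat (- 2 * n))"

lemma basis_exponent_position [simp]: "basis_exponent (basis_position n) = n"
  by (auto simp: basis_exponent_def basis_position_def even_nat_iff)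

lemma basis_position_exponent [simp]: "basis_position (basis_exponent j) = j"
  by (cases "odd j") (auto simp: basis_exponent_def basis_position_def elim!: oddE evenE)

text \<open>Gram--Schmidt without normalisation, so that the leading coefficient is 1.\<close>

function jacobi_gs :: "multiplicity \<Rightarrow> nat \<Rightarrow> laurent_poly" where
  "jacobi_gs k j =
     laurent_monom (basis_exponent j) -
     (\<Sum>i<j. laurent_const
        (jacobi_inner k (jacobi_gs k i) (laurent_monom (basis_exponent j)) /
         jacobi_inner k (jacobi_gs k i) (jacobi_gs k i)) * jacobi_gs k i)"
  by pat_completeness auto
termination
  by (relation "Wellfounded.measure snd") auto

declare jacobi_gs.simps [simp del]

definition nonsym_jacobi :: "int \<Rightarrow> multiplicity \<Rightarrow> laurent_poly" where
  "nonsym_jacobi n k = jacobi_gs k (basis_position n)"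

datatype weyl = Weyl_1 | Weyl_s

instantiation weyl :: comm_monoid_mult
begin

definition one_weyl :: weyl where
  "one_weyl = Weyl_1"

definition times_weyl :: "weyl \<Rightarrow> weyl \<Rightarrow> weyl" where
  "times_weyl v w = (if v = w then Weyl_1 else Weyl_s)"

instance
proof
  fix a b c :: weyl
  show "a * b * c = a * (b * c)"
    by (cases a; cases b; cases c) (simp_all add: times_weyl_def)
  show "a * b = b * a"
    by (simp add: times_weyl_def)
  show "1 * a = a"
    by (cases a) (simp_all add: times_weyl_def one_weyl_def)
qed

end

text \<open>\<open>weyl_upper n\<close> is \<open>w\<^sup>\<lambda>\<close> and \<open>weyl_lower n\<close> is \<open>w\<^sub>\<lambda>\<close>, for \<open>\<lambda> = n\<epsilon>\<close>.\<close>

definition weyl_upper :: "int \<Rightarrow> weyl" where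
  "weyl_upper n = (if n \<ge> 0 then 1 else Weyl_s)"

definition weyl_lower :: "int \<Rightarrow> weyl" where
  "weyl_lower n = (if n = 0 then Weyl_s else 1)"

definition dominant :: "int \<Rightarrow> int" where
  "dominant n = \<bar>n\<bar>"

fun c_tilde :: "weyl \<Rightarrow> real \<Rightarrow> multiplicity \<Rightarrow> real" where
  "c_tilde Weyl_1 t (k1, k2) =
     (Gamma t * Gamma (t + 1/2)) /
     (2 powi k1 * Gamma (t + of_int k1 / 2 + 1/2) * Gamma (t + of_int k1 / 2 + of_int k2))"
| "c_tilde Weyl_s t (k1, k2) =
     (Gamma (t + 1/2) * Gamma (t + 1)) /
     (2 powi k1 * Gamma (t + of_int k1 / 2 + 1/2) * Gamma (t + of_int k1 / 2 + of_int k2 + 1))"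

fun c_star :: "weyl \<Rightarrow> real \<Rightarrow> multiplicity \<Rightarrow> real" where
  "c_star Weyl_1 t (k1, k2) =
     (Gamma (- t - of_int k1 / 2 + 1/2) * Gamma (- t - of_int k1 / 2 - of_int k2)) /
     (2 powi k1 * Gamma (- t) * Gamma (- t + 1/2))"
| "c_star Weyl_s t (k1, k2) =
     (Gamma (- t - of_int k1 / 2 + 1/2) * Gamma (- t - of_int k1 / 2 - of_int k2 + 1)) /
     (2 powi k1 * Gamma (- t + 1/2) * Gamma (- t + 1))"

end

theory Submission
  imports Defs
begin

text \<open>
  Put \<open>a = k\<^sub>1 + k\<^sub>2\<close>, \<open>b = k\<^sub>2\<close>, \<open>s = a + b = 2\<rho>\<close> and \<open>d = a - b = k\<^sub>1\<close>. The weight is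
  \<open>\<delta> = (2 - z - 1/z)\<^sup>a (2 + z + 1/z)\<^sup>b\<close>, and with \<open>\<theta> = z d/dz\<close> its logarithmic derivative
  \<open>\<theta>\<delta>/\<delta> = (s z\<^sup>2 + 2 d z + s) / (z\<^sup>2 - 1)\<close> is rational (\<open>pearson_equation\<close>). It follows that the
  Dunkl--Cherednik operator
  \<open>Y f = \<theta>f + k\<^sub>1 (f - \<sigma>f)/(1 - 1/z) + 2 k\<^sub>2 (f - \<sigma>f)/(1 - 1/z\<^sup>2) - \<rho> f\<close>, where \<open>\<sigma>f(z) = f(1/z)\<close>,
  is symmetric for the inner product, so that its eigenfunctions for different eigenvalues are
  orthogonal (\<open>dunkl_eigen_orthogonal\<close>).

  The reflection \<open>\<sigma>\<close> and the affine reflection \<open>z\<sigma>\<close> conjugate \<open>Y\<close>, up to a multiple of the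
  reflection itself, into \<open>-Y\<close> and \<open>1 - Y\<close>. Hence if \<open>f\<close> is an eigenfunction, then its
  reflection plus a suitable multiple of \<open>f\<close> is an eigenfunction again (\<open>dunkl_eigen_intertwine_s\<close>,
  \<open>dunkl_eigen_intertwine_affine\<close>). Starting from \<open>1\<close> and using the two reflections alternately
  gives a sequence \<open>F\<^sub>j\<close>. In the ordered basis \<open>1, z, 1/z, z\<^sup>2, \<dots>\<close> the reflection used at step \<open>j\<close>
  exchanges the monomials number \<open>j\<close> and \<open>j + 1\<close> and permutes the earlier ones, so \<open>F\<^sub>j\<close> is the
  \<open>j\<close>-th monomial plus earlier ones. The eigenvalues are distinct, the \<open>F\<^sub>j\<close> are therefore
  orthogonal, and so they are the result of the Gram--Schmidt process (\<open>jacobi_gs_eq_jacobi_poly\<close>).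

  Reflections are isometries. Thus \<open>F\<^sub>j\<^sub>+\<^sub>1 = R F\<^sub>j + \<gamma> F\<^sub>j\<close> with \<open>F\<^sub>j\<^sub>+\<^sub>1\<close> orthogonal to \<open>F\<^sub>j\<close> gives
  \<open>\<parallel>F\<^sub>j\<^sub>+\<^sub>1\<parallel>\<^sup>2 = (1 - \<gamma>\<^sup>2) \<parallel>F\<^sub>j\<parallel>\<^sup>2\<close> by Pythagoras; this is the Szego recursion on the unit circle in
  disguise. Only the total mass \<open>\<parallel>1\<parallel>\<^sup>2\<close> is left. The Pearson equation relates the first moment of
  the weight to its mass, which shows how the mass changes when \<open>a\<close> or \<open>b\<close> grows by one
  (\<open>circle_mean_jacobi_weight\<close>). The quotients of \<open>c\<close>-functions satisfy the same recursion as the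
  norms, by the functional equation of the Gamma function (\<open>c_quotient_steps\<close>).
\<close>

section \<open>Means over the unit circle\<close>

definition circle_mean :: "(complex \<Rightarrow> complex) \<Rightarrow> complex" where
  "circle_mean f = integral {0..1} (\<lambda>t. f (cis (2 * pi * t)))"

lemma circle_mean_integrable:
  fixes f :: "complex \<Rightarrow> complex"
  assumes "continuous_on (sphere 0 1) f"
  shows "(\<lambda>t. f (cis (2 * pi * t))) integrable_on {0..1}"
proof (rule integrable_continuous_real, rule continuous_on_compose2[OF assms])
  show "continuous_on {0..1} (\<lambda>t. cis (2 * pi * t))"
    by (intro continuous_intros)
qed auto

lemma contour_integral_circlepath_eq_mean:
  "contour_integral (circlepath 0 1) (\<lambda>z. f z / (2 * of_real pi * \<i> * z)) = circle_mean f"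
  unfolding contour_integral_integral circle_mean_def
proof (intro integral_cong)
  fix t :: real
  have "circlepath 0 1 t = cis (2 * pi * t)"
    by (simp add: circlepath cis_conv_exp mult_ac)
  moreover have "vector_derivative (circlepath 0 1) (at t) = 2 * of_real pi * \<i> * cis (2 * pi * t)"
    by (simp add: vector_derivative_circlepath cis_conv_exp mult_ac)
  ultimately show "f (circlepath 0 1 t) / (2 * of_real pi * \<i> * circlepath 0 1 t) *
      vector_derivative (circlepath 0 1) (at t) = f (cis (2 * pi * t))"
    by simp
qed

lemma circle_mean_cong:
  "(\<And>z. norm z = 1 \<Longrightarrow> f z = g z) \<Longrightarrow> circle_mean f = circle_mean g"
  unfolding circle_mean_def by (intro integral_cong) simp

lemma circle_mean_add:
  assumes "continuous_on (sphere 0 1) f" "continuous_on (sphere 0 1) g"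
  shows "circle_mean (\<lambda>z. f z + g z) = circle_mean f + circle_mean g"
  unfolding circle_mean_def by (intro integral_add circle_mean_integrable assms)

lemma circle_mean_diff:
  assumes "continuous_on (sphere 0 1) f" "continuous_on (sphere 0 1) g"
  shows "circle_mean (\<lambda>z. f z - g z) = circle_mean f - circle_mean g"
  unfolding circle_mean_def by (intro integral_diff circle_mean_integrable assms)

lemma circle_mean_cmult: "circle_mean (\<lambda>z. c * f z) = c * circle_mean f"
  by (simp add: circle_mean_def)

text \<open>On the circle \<open>1/z\<close> is complex conjugation, that is, the parameter \<open>t\<close> becomes \<open>1 - t\<close>.\<close>
lemma circle_mean_inverse: "circle_mean (\<lambda>z. f (inverse z)) = circle_mean f"
proof -
  define g where "g t = f (cis (2 * pi * t))" for t :: real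
  have "f (inverse (cis (2 * pi * t))) = g (1 - t)" for t
  proof -
    have "cis (2 * pi * (1 - t)) = cis (2 * pi) * cis (- (2 * pi * t))"
      by (simp only: cis_mult) (simp add: algebra_simps)
    then show ?thesis by (simp add: g_def)
  qed
  then have "circle_mean (\<lambda>z. f (inverse z)) = integral {0..1} (\<lambda>t. g (1 - t))"
    by (simp add: circle_mean_def)
  also have "\<dots> = integral {0..1} g"
  proof -
    have "((\<lambda>t. g (1 - t)) has_integral c) {0..1} \<longleftrightarrow> (g has_integral c) {0..1}" for c
    proof -
      have "((\<lambda>t. g (1 - t)) has_integral c) {0..1} \<longleftrightarrow>
          ((\<lambda>u. g (1 + u)) has_integral c) {-1..0}"
        using has_integral_reflect_real[where f = "\<lambda>u. g (1 + u)" and i = c and a = "-1" and b = 0]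
        by (simp only: minus_minus minus_zero diff_conv_add_uminus)
      also have "\<dots> \<longleftrightarrow> (g has_integral c) {0..1}"
        using has_integral_shift_Icc_real[of g 1 c "-1" 0] by (simp add: o_def)
      finally show ?thesis .
    qed
    then show ?thesis by (simp add: integral_def integrable_on_def)
  qed
  finally show ?thesis by (simp only: circle_mean_def g_def[abs_def])
qed

lemma circle_mean_eq_0_if_odd:
  assumes "\<And>z. norm z = 1 \<Longrightarrow> f (inverse z) = - f z"
  shows "circle_mean f = 0"
proof -
  have "circle_mean f = circle_mean (\<lambda>z. f (inverse z))"
    by (rule circle_mean_inverse[symmetric])
  also have "\<dots> = circle_mean (\<lambda>z. (- 1) * f z)"
    by (intro circle_mean_cong) (simp add: assms)
  also have "\<dots> = - circle_mean f"
    using circle_mean_cmult[of "- 1" f] by simp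
  finally show ?thesis by simp
qed

text \<open>
  The function \<open>z f'(z)\<close> is, up to a constant factor, the derivative of \<open>f\<close> along the closed circle.
  All integrations by parts below are instances of this lemma.
\<close>
lemma circle_mean_theta:
  assumes "f holomorphic_on - {0}"
  shows "circle_mean (\<lambda>z. z * deriv f z) = 0"
proof -
  have "((\<lambda>t. f (cis (2 * pi * t))) has_vector_derivative
          (2 * pi * \<i>) * (cis (2 * pi * t) * deriv f (cis (2 * pi * t)))) (at t within {0..1})" for t
  proof -
    have f: "(f has_field_derivative deriv f (cis (2 * pi * t))) (at (cis (2 * pi * t)))"
      by (rule holomorphic_derivI[OF assms]) auto
    have "((\<lambda>t. cis (2 * pi * t)) has_vector_derivative (2 * pi) *\<^sub>R (\<i> * cis (2 * pi * t)))
            (at t within {0..1})"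
      using exp_scaleR_has_vector_derivative_right[of "2 * pi * \<i>" t]
      by (simp add: cis_conv_exp scaleR_conv_of_real mult_ac)
    from field_vector_diff_chain_within[OF this has_field_derivative_at_within[OF f]]
    show ?thesis by (simp add: o_def scaleR_conv_of_real algebra_simps)
  qed
  then have "((\<lambda>t. (2 * pi * \<i>) * (cis (2 * pi * t) * deriv f (cis (2 * pi * t)))) has_integral
      f (cis (2 * pi * 1)) - f (cis (2 * pi * 0))) {0..1}"
    by (intro fundamental_theorem_of_calculus) auto
  then have "circle_mean (\<lambda>z. (2 * pi * \<i>) * (z * deriv f z)) = 0"
    unfolding circle_mean_def by (simp only: integral_unique) simp
  then show ?thesis
    using circle_mean_cmult[of "2 * pi * \<i>" "\<lambda>z. z * deriv f z"] by simp
qed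

section \<open>The weight\<close>

definition jacobi_weight :: "nat \<Rightarrow> nat \<Rightarrow> complex \<Rightarrow> complex" where
  "jacobi_weight a b z = (2 - z - inverse z) ^ a * (2 + z + inverse z) ^ b"

text \<open>
  The derivative \<open>\<theta>\<delta>\<close> of the weight, written as a Laurent polynomial rather than as a multiple of
  the weight, because the logarithmic derivative has poles at \<open>1\<close> and \<open>-1\<close>.
\<close>
definition jacobi_weight_theta :: "nat \<Rightarrow> nat \<Rightarrow> complex \<Rightarrow> complex" where
  "jacobi_weight_theta a b z =
     (z - inverse z) *
     (of_nat b * (2 - z - inverse z) ^ a * (2 + z + inverse z) ^ (b - 1) -
      of_nat a * (2 - z - inverse z) ^ (a - 1) * (2 + z + inverse z) ^ b)"

lemma jacobi_weight_inverse: "jacobi_weight a b (inverse z) = jacobi_weight a b z"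
  by (simp add: jacobi_weight_def algebra_simps)

lemma jacobi_weight_theta_inverse:
  "jacobi_weight_theta a b (inverse z) = - jacobi_weight_theta a b z"
  by (simp add: jacobi_weight_theta_def algebra_simps)

lemma jacobi_weight_holomorphic [holomorphic_intros]: "jacobi_weight a b holomorphic_on - {0}"
  unfolding jacobi_weight_def by (intro holomorphic_intros) auto

lemma deriv_jacobi_weight:
  assumes "z \<noteq> 0"
  shows "z * deriv (jacobi_weight a b) z = jacobi_weight_theta a b z"
proof -
  have "(jacobi_weight a b has_field_derivative jacobi_weight_theta a b z / z) (at z)"
  proof -
    have x: "((\<lambda>z. 2 - z - inverse z) has_field_derivative - (z - inverse z) / z) (at z)"
      using assms by (auto intro!: derivative_eq_intros simp: field_simps)
    have y: "((\<lambda>z. 2 + z + inverse z) has_field_derivative (z - inverse z) / z) (at z)"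
      using assms by (auto intro!: derivative_eq_intros simp: field_simps)
    show ?thesis
      unfolding jacobi_weight_def
      by (rule DERIV_cong[OF DERIV_mult[OF DERIV_power[OF x] DERIV_power[OF y]]])
         (simp add: jacobi_weight_theta_def diff_divide_distrib ring_distribs mult_ac)
  qed
  then show ?thesis using assms by (simp add: DERIV_imp_deriv)
qed

text \<open>
  With \<open>x = 2 - z - 1/z\<close>, \<open>y = 2 + z + 1/z\<close> and \<open>u = z - 1/z\<close> one has \<open>x y = - u\<^sup>2\<close>, so multiplying
  \<open>\<theta>\<delta>\<close> by another factor \<open>u\<close> restores the exponents \<open>a\<close> and \<open>b\<close>.
\<close>
lemma pearson_equation:
  assumes "z \<noteq> 0" "s = of_nat a + of_nat b" "d = of_nat a - of_nat b"
  shows "(z\<^sup>2 - 1) * jacobi_weight_theta a b z = (s * z\<^sup>2 + 2 * d * z + s) * jacobi_weight a b z"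
proof -
  define x where "x = 2 - z - inverse z"
  define y where "y = 2 + z + inverse z"
  define u where "u = z - inverse z"
  have xy: "x * y = - u\<^sup>2" using assms(1) by (simp add: x_def y_def u_def field_simps power2_eq_square)
  have u: "z\<^sup>2 - 1 = z * u" using assms(1) by (simp add: u_def field_simps power2_eq_square)
  have P: "s * z\<^sup>2 + 2 * d * z + s = z * (of_nat a * y - of_nat b * x)"
    unfolding x_def y_def assms(2,3) using assms(1) by (simp add: field_simps power2_eq_square)
  have a: "of_nat a * x ^ a = of_nat a * (x * x ^ (a - 1))" by (cases a) auto
  have b: "of_nat b * y ^ b = of_nat b * (y * y ^ (b - 1))" by (cases b) auto
  have "u * (u * (of_nat b * x ^ a * y ^ (b - 1) - of_nat a * x ^ (a - 1) * y ^ b))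
      = - (x * y) * (of_nat b * x ^ a * y ^ (b - 1) - of_nat a * x ^ (a - 1) * y ^ b)"
    by (simp add: xy power2_eq_square)
  also have "\<dots> = of_nat a * x ^ a * y * y ^ b - of_nat b * y ^ b * x * x ^ a"
    unfolding a b by (simp add: algebra_simps)
  also have "\<dots> = (of_nat a * y - of_nat b * x) * (x ^ a * y ^ b)"
    by (simp add: algebra_simps)
  finally show ?thesis
    unfolding u P jacobi_weight_theta_def jacobi_weight_def
    unfolding x_def[symmetric] y_def[symmetric] u_def[symmetric] by (simp add: mult.assoc)
qed

section \<open>Evaluation of Laurent polynomials\<close>

lemma laurent_eval_superset:
  assumes "finite A" "Poly_Mapping.keys f \<subseteq> A"
  shows "laurent_eval f z = (\<Sum>n\<in>A. Poly_Mapping.lookup f n * z powi n)"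
  unfolding laurent_eval_def using assms
  by (intro sum.mono_neutral_left) (auto simp: in_keys_iff)

lemma lookup_scale:
  fixes f :: laurent_poly
  shows "Poly_Mapping.lookup (laurent_const c * f) n = c * Poly_Mapping.lookup f n"
  by (simp add: mult_map_scale_conv_mult[symmetric] Poly_Mapping.map.rep_eq when_def)

lemma laurent_eval_add: "laurent_eval (f + g) z = laurent_eval f z + laurent_eval g z"
proof -
  define A where "A = Poly_Mapping.keys f \<union> Poly_Mapping.keys g"
  have "laurent_eval h z = (\<Sum>n\<in>A. Poly_Mapping.lookup h n * z powi n)" if "h \<in> {f, g, f + g}" for h
    using that Poly_Mapping.keys_add[of f g]
    by (intro laurent_eval_superset) (auto simp: A_def)
  then show ?thesis by (simp add: lookup_add sum.distrib algebra_simps)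
qed

lemma laurent_eval_scale: "laurent_eval (laurent_const c * f) z = c * laurent_eval f z"
proof -
  have "laurent_eval (laurent_const c * f) z =
      (\<Sum>n\<in>Poly_Mapping.keys f. Poly_Mapping.lookup (laurent_const c * f) n * z powi n)"
    by (intro laurent_eval_superset) (auto simp: in_keys_iff lookup_scale)
  then show ?thesis by (simp add: laurent_eval_def lookup_scale sum_distrib_left mult.assoc)
qed

lemma laurent_eval_one: "laurent_eval 1 z = 1"
  by (simp add: laurent_eval_def lookup_one)


lemma laurent_eval_holomorphic: "laurent_eval f holomorphic_on - {0}"
  unfolding laurent_eval_def by (intro holomorphic_intros) auto

definition real_coeffs :: "laurent_poly \<Rightarrow> bool" where
  "real_coeffs f \<longleftrightarrow> (\<forall>n. Poly_Mapping.lookup f n \<in> \<real>)"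

lemma cnj_laurent_eval:
  assumes "real_coeffs f" "norm z = 1"
  shows "cnj (laurent_eval f z) = laurent_eval f (inverse z)"
proof -
  have "cnj z = inverse z"
    using assms(2) complex_norm_square[of z] by (intro inverse_unique[symmetric]) simp
  then show ?thesis
    using assms(1) by (auto simp: laurent_eval_def real_coeffs_def Reals_cnj_iff intro!: sum.cong)
qed

text \<open>The map \<open>f(z) \<mapsto> z\<^sup>c f(1/z)\<close>.\<close>
definition laurent_reflect :: "int \<Rightarrow> laurent_poly \<Rightarrow> laurent_poly" where
  "laurent_reflect c f = Poly_Mapping.map_key (\<lambda>n. c - n) f"

lemma lookup_laurent_reflect:
  "Poly_Mapping.lookup (laurent_reflect c f) n = Poly_Mapping.lookup f (c - n)"
  unfolding laurent_reflect_def by (subst Poly_Mapping.map_key.rep_eq) (auto simp: inj_def)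

lemma laurent_eval_reflect:
  assumes "z \<noteq> 0"
  shows "laurent_eval (laurent_reflect c f) z = z powi c * laurent_eval f (inverse z)"
  unfolding laurent_eval_def sum_distrib_left
  by (rule sum.reindex_bij_witness[where i = "\<lambda>n. c - n" and j = "\<lambda>n. c - n"])
     (use assms in \<open>auto simp: in_keys_iff lookup_laurent_reflect power_int_diff power_int_inverse
        field_simps\<close>)

section \<open>Eigenfunctions of the Dunkl--Cherednik operator and intertwiners\<close>

text \<open>
  This is the equation \<open>Y f = l f\<close> for the Dunkl--Cherednik operator with parameters \<open>k\<^sub>1 = d\<close> and
  \<open>k\<^sub>2 = (s - d)/2\<close>, multiplied by \<open>z\<^sup>2 - 1\<close>. In this form no divided differences of Laurent
  polynomials are needed.
\<close>
definition dunkl_eigen :: "complex \<Rightarrow> complex \<Rightarrow> complex \<Rightarrow> (complex \<Rightarrow> complex) \<Rightarrow> bool" where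
  "dunkl_eigen s d l f \<longleftrightarrow> f holomorphic_on - {0} \<and>
     (\<forall>z. z \<noteq> 0 \<longrightarrow> (z\<^sup>2 - 1) * (z * deriv f z - l * f z) + (s * z\<^sup>2 + 2 * d * z + s) / 2 * f z =
        (s * z\<^sup>2 + d * z) * f (inverse z))"

lemma dunkl_eigen_cong:
  assumes "dunkl_eigen s d l f" "\<And>z. z \<noteq> 0 \<Longrightarrow> f z = g z"
  shows "dunkl_eigen s d l g"
proof -
  have "g holomorphic_on - {0}"
    using assms by (auto simp: dunkl_eigen_def intro: holomorphic_transform)
  moreover have "deriv f z = deriv g z" if "z \<noteq> 0" for z
    using assms that calculation
    by (intro complex_derivative_transform_within_open[of f "- {0}"]) (auto simp: dunkl_eigen_def)
  ultimately show ?thesis using assms by (auto simp: dunkl_eigen_def)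
qed

lemma dunkl_eigen_one: "dunkl_eigen s d (- s / 2) (\<lambda>_. 1)"
  by (auto simp: dunkl_eigen_def field_simps)

text \<open>
  The eigenvalue equation at the point \<open>1/z\<close>, multiplied by \<open>z\<^sup>2\<close>. It describes how the operator acts
  on the reflection of \<open>f\<close>: the error compared with an eigenvalue equation is a multiple of \<open>f\<close>.
\<close>
lemma dunkl_eigen_reflected_equation:
  assumes "dunkl_eigen s d l f" "z \<noteq> 0"
  shows "(1 - z\<^sup>2) * (deriv f (inverse z) / z - l * f (inverse z)) +
      (s * z\<^sup>2 + 2 * d * z + s) / 2 * f (inverse z) = (s + d * z) * f z"
proof -
  define w where "w = inverse z"
  have w: "w \<noteq> 0" "inverse w = z" using assms(2) by (auto simp: w_def)
  have zw: "z * w = 1" using assms(2) by (simp add: w_def)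
  have "(w\<^sup>2 - 1) * (w * deriv f w - l * f w) + (s * w\<^sup>2 + 2 * d * w + s) / 2 * f w =
      (s * w\<^sup>2 + d * w) * f z"
    using assms(1) w by (auto simp: dunkl_eigen_def)
  then have eq: "z\<^sup>2 * ((w\<^sup>2 - 1) * (w * deriv f w - l * f w) +
      (s * w\<^sup>2 + 2 * d * w + s) / 2 * f w) = z\<^sup>2 * ((s * w\<^sup>2 + d * w) * f z)" by simp
  have "z\<^sup>2 * w\<^sup>2 = 1" "z\<^sup>2 * w = z"
    using zw by algebra+
  then have "z\<^sup>2 * ((w\<^sup>2 - 1) * X + (s * w\<^sup>2 + 2 * d * w + s) / 2 * Y) =
      (1 - z\<^sup>2) * X + (s * z\<^sup>2 + 2 * d * z + s) / 2 * Y"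
      "z\<^sup>2 * ((s * w\<^sup>2 + d * w) * Y) = (s + d * z) * Y" for X Y :: complex
    by algebra+
  from eq[unfolded this] show ?thesis
    unfolding w_def by (simp only: divide_inverse mult.commute[of "inverse z"])
qed

text \<open>
  Write \<open>Y\<close> for the operator. By the reflected equation, \<open>Y + l\<close> maps the reflection of \<open>f\<close> to
  \<open>- s f\<close>, while it maps \<open>f\<close> to \<open>2 l f\<close>. The multiple of \<open>f\<close> is chosen so that these cancel.
\<close>
lemma dunkl_eigen_intertwine_s:
  assumes "dunkl_eigen s d l f" "l \<noteq> 0"
  shows "dunkl_eigen s d (- l) (\<lambda>z. f (inverse z) + s / (2 * l) * f z)"
proof -
  define g where "g = s / (2 * l)"
  have g: "2 * l * g = s" using assms(2) by (simp add: g_def)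
  have hol: "f holomorphic_on - {0}" using assms by (simp add: dunkl_eigen_def)
  have D: "((\<lambda>z. f (inverse z) + g * f z) has_field_derivative
      - (deriv f (inverse z) / z\<^sup>2) + g * deriv f z) (at z)" if "z \<noteq> 0" for z
  proof -
    have "(f has_field_derivative deriv f z) (at z)"
         "(f has_field_derivative deriv f (inverse z)) (at (inverse z))"
      using that by (auto intro!: holomorphic_derivI[OF hol])
    from this(1) DERIV_chain2[OF this(2) DERIV_inverse[OF that]] show ?thesis
      by (auto intro!: derivative_eq_intros simp: field_simps power2_eq_square)
  qed
  show ?thesis
    unfolding dunkl_eigen_def g_def[symmetric]
  proof (intro conjI allI impI)
    show "(\<lambda>z. f (inverse z) + g * f z) holomorphic_on - {0}"
      unfolding holomorphic_on_def field_differentiable_def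
      using D has_field_derivative_at_within by blast
    fix z :: complex assume z: "z \<noteq> 0"
    define F G DF DG where "F = f z" "G = f (inverse z)" "DF = z * deriv f z" "DG = deriv f (inverse z) / z"
    note defs = this
    have 1: "(z\<^sup>2 - 1) * (DF - l * F) + (s * z\<^sup>2 + 2 * d * z + s) / 2 * F = (s * z\<^sup>2 + d * z) * G"
      using assms(1) z by (simp add: dunkl_eigen_def defs)
    have 2: "(1 - z\<^sup>2) * (DG - l * G) + (s * z\<^sup>2 + 2 * d * z + s) / 2 * G = (s + d * z) * F"
      using dunkl_eigen_reflected_equation[OF assms(1) z] by (simp add: defs)
    have 3: "z * deriv (\<lambda>z. f (inverse z) + g * f z) z = - DG + g * DF"
      unfolding DERIV_imp_deriv[OF D[OF z]] defs using z by (simp add: field_simps power2_eq_square)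
    have "(z\<^sup>2 - 1) * (- DG + g * DF + l * (G + g * F)) + (s * z\<^sup>2 + 2 * d * z + s) / 2 * (G + g * F)
        = ((1 - z\<^sup>2) * (DG - l * G) + (s * z\<^sup>2 + 2 * d * z + s) / 2 * G)
         + g * ((z\<^sup>2 - 1) * (DF - l * F) + (s * z\<^sup>2 + 2 * d * z + s) / 2 * F)
         + 2 * l * g * (z\<^sup>2 - 1) * F" by algebra
    also have "\<dots> = (s * z\<^sup>2 + d * z) * (F + g * G)"
      unfolding 1 2 g by algebra
    finally show "(z\<^sup>2 - 1) * (z * deriv (\<lambda>z. f (inverse z) + g * f z) z - - l * (f (inverse z) + g * f z)) +
        (s * z\<^sup>2 + 2 * d * z + s) / 2 * (f (inverse z) + g * f z) =
        (s * z\<^sup>2 + d * z) * (f (inverse (inverse z)) + g * f (inverse z))"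
      unfolding 3 by (simp add: defs)
  qed
qed

text \<open>
  The same for the affine reflection \<open>z f(1/z)\<close>. The additional factor \<open>z\<close> shifts the eigenvalue
  by one, and now \<open>Y - (1 - l)\<close> maps the reflected function to \<open>d f\<close> and \<open>f\<close> to \<open>(2 l - 1) f\<close>.
\<close>
lemma dunkl_eigen_intertwine_affine:
  assumes "dunkl_eigen s d l f" "1 - 2 * l \<noteq> 0"
  shows "dunkl_eigen s d (1 - l) (\<lambda>z. z * f (inverse z) + d / (1 - 2 * l) * f z)"
proof -
  define g where "g = d / (1 - 2 * l)"
  have g: "(1 - 2 * l) * g = d" using assms(2) by (simp add: g_def)
  have hol: "f holomorphic_on - {0}" using assms by (simp add: dunkl_eigen_def)
  have D: "((\<lambda>z. z * f (inverse z) + g * f z) has_field_derivative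
      f (inverse z) - deriv f (inverse z) / z + g * deriv f z) (at z)" if "z \<noteq> 0" for z
  proof -
    have "(f has_field_derivative deriv f z) (at z)"
         "(f has_field_derivative deriv f (inverse z)) (at (inverse z))"
      using that by (auto intro!: holomorphic_derivI[OF hol])
    from this(1) DERIV_chain2[OF this(2) DERIV_inverse[OF that]] show ?thesis
      using that by (auto intro!: derivative_eq_intros simp: field_simps power2_eq_square)
  qed
  show ?thesis
    unfolding dunkl_eigen_def g_def[symmetric]
  proof (intro conjI allI impI)
    show "(\<lambda>z. z * f (inverse z) + g * f z) holomorphic_on - {0}"
      unfolding holomorphic_on_def field_differentiable_def
      using D has_field_derivative_at_within by blast
    fix z :: complex assume z: "z \<noteq> 0"
    define F G DF DG where "F = f z" "G = f (inverse z)" "DF = z * deriv f z" "DG = deriv f (inverse z) / z"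
    note defs = this
    have 1: "(z\<^sup>2 - 1) * (DF - l * F) + (s * z\<^sup>2 + 2 * d * z + s) / 2 * F = (s * z\<^sup>2 + d * z) * G"
      using assms(1) z by (simp add: dunkl_eigen_def defs)
    have 2: "(1 - z\<^sup>2) * (DG - l * G) + (s * z\<^sup>2 + 2 * d * z + s) / 2 * G = (s + d * z) * F"
      using dunkl_eigen_reflected_equation[OF assms(1) z] by (simp add: defs)
    have 3: "z * deriv (\<lambda>z. z * f (inverse z) + g * f z) z = z * (G - DG) + g * DF"
      unfolding DERIV_imp_deriv[OF D[OF z]] defs using z by (simp add: algebra_simps)
    have "(z\<^sup>2 - 1) * (z * (G - DG) + g * DF - (1 - l) * (z * G + g * F)) +
          (s * z\<^sup>2 + 2 * d * z + s) / 2 * (z * G + g * F)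
        = z * ((1 - z\<^sup>2) * (DG - l * G) + (s * z\<^sup>2 + 2 * d * z + s) / 2 * G)
         + g * ((z\<^sup>2 - 1) * (DF - l * F) + (s * z\<^sup>2 + 2 * d * z + s) / 2 * F)
         - (1 - 2 * l) * g * (z\<^sup>2 - 1) * F" by algebra
    also have "\<dots> = (s * z + d) * F + g * (s * z\<^sup>2 + d * z) * G"
      unfolding 1 2 g by algebra
    also have "\<dots> = (s * z\<^sup>2 + d * z) * (inverse z * F + g * G)"
      using z by (simp add: field_simps power2_eq_square)
    finally show "(z\<^sup>2 - 1) * (z * deriv (\<lambda>z. z * f (inverse z) + g * f z) z -
          (1 - l) * (z * f (inverse z) + g * f z)) +
        (s * z\<^sup>2 + 2 * d * z + s) / 2 * (z * f (inverse z) + g * f z) =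
        (s * z\<^sup>2 + d * z) * (inverse z * f (inverse (inverse z)) + g * f (inverse z))"
      unfolding 3 by (simp add: defs)
  qed
qed

section \<open>Orthogonality\<close>

text \<open>
  The eigenvalue equation divided by \<open>z\<^sup>2 - 1\<close> and multiplied by the weight: the Pearson equation
  absorbs the denominator into the derivative of the weight. At the zeros of \<open>z\<^sup>2 - 1\<close> the weight
  vanishes and \<open>z = 1/z\<close>, so the equation holds there for trivial reasons.
\<close>
lemma dunkl_eigen_weighted:
  assumes eig: "dunkl_eigen s d n h" and z: "z \<noteq> 0" and ab: "a \<ge> 1" "b \<ge> 1"
    and s: "s = of_nat a + of_nat b" and d: "d = of_nat a - of_nat b"
  shows "jacobi_weight a b z * (z * deriv h z - n * h z) +
      jacobi_weight_theta a b z / 2 * (h z - h (inverse z)) -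
      s / 2 * jacobi_weight a b z * h (inverse z) = 0"
proof (cases "z\<^sup>2 = 1")
  case True
  then have "z = 1 \<or> z = - 1" by (simp add: power2_eq_1_iff)
  then show ?thesis using ab by (auto simp: jacobi_weight_def)
next
  case False
  define w W H H' D where "w = jacobi_weight a b z" "W = jacobi_weight_theta a b z"
    "H = h z" "H' = h (inverse z)" "D = z * deriv h z"
  note defs = this
  have 1: "(z\<^sup>2 - 1) * (D - n * H) + (s * z\<^sup>2 + 2 * d * z + s) / 2 * H = (s * z\<^sup>2 + d * z) * H'"
    using eig z by (simp add: dunkl_eigen_def defs)
  have 2: "(z\<^sup>2 - 1) * W = (s * z\<^sup>2 + 2 * d * z + s) * w"
    using pearson_equation[OF z s d] by (simp add: defs)
  have "(z\<^sup>2 - 1) * (w * (D - n * H) + W / 2 * (H - H') - s / 2 * w * H') =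
      w * ((z\<^sup>2 - 1) * (D - n * H)) + ((z\<^sup>2 - 1) * W) / 2 * (H - H') - s / 2 * (z\<^sup>2 - 1) * w * H'"
    by algebra
  also have "\<dots> = w * ((z\<^sup>2 - 1) * (D - n * H) + (s * z\<^sup>2 + 2 * d * z + s) / 2 * H) -
      w * (s * z\<^sup>2 + d * z) * H'"
    unfolding 2 by algebra
  also have "\<dots> = 0" unfolding 1 by simp
  finally show ?thesis using False by (simp add: defs)
qed

text \<open>
  Multiply the weighted equation for \<open>g\<close> at \<open>z\<close> by \<open>f(1/z)\<close>, multiply the one for \<open>f\<close> at \<open>1/z\<close> by
  \<open>g(z)\<close>, and subtract. With \<open>H(z) = f(1/z) g(z) \<delta>(z)\<close> the derivatives combine to \<open>\<theta>H\<close>, the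
  eigenvalues contribute \<open>(l - m) H\<close>, and everything else is the function \<open>Q\<close>, which is odd under
  \<open>z \<mapsto> 1/z\<close>. The functions \<open>\<theta>H\<close> and \<open>Q\<close> both have mean zero.
\<close>
theorem dunkl_eigen_orthogonal:
  assumes f: "dunkl_eigen s d l f" and g: "dunkl_eigen s d m g" and lm: "l \<noteq> m"
    and ab: "a \<ge> 1" "b \<ge> 1"
    and s: "s = of_nat a + of_nat b" and d: "d = of_nat a - of_nat b"
  shows "circle_mean (\<lambda>z. f (inverse z) * g z * jacobi_weight a b z) = 0"
proof -
  define w W where "w = jacobi_weight a b" "W = jacobi_weight_theta a b"
  note w_defs = this
  define H where "H = (\<lambda>z. f (inverse z) * g z * w z)"
  define Q where "Q = (\<lambda>z. W z / 2 * (f (inverse z) * g (inverse z) + f z * g z) +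
    s / 2 * w z * (f (inverse z) * g (inverse z) - f z * g z))"
  have hol: "f holomorphic_on - {0}" "g holomorphic_on - {0}" "w holomorphic_on - {0}"
    using f g jacobi_weight_holomorphic by (auto simp: dunkl_eigen_def w_defs)
  have D: "(H has_field_derivative - (deriv f (inverse z) / z\<^sup>2) * g z * w z +
      f (inverse z) * deriv g z * w z + f (inverse z) * g z * deriv w z) (at z)"
    if "z \<noteq> 0" for z
  proof -
    have "(f has_field_derivative deriv f (inverse z)) (at (inverse z))"
         "(g has_field_derivative deriv g z) (at z)" "(w has_field_derivative deriv w z) (at z)"
      using that hol by (auto intro!: holomorphic_derivI)
    from DERIV_chain2[OF this(1) DERIV_inverse[OF that]] this(2,3) show ?thesis
      unfolding H_def
      by (auto intro!: derivative_eq_intros simp: field_simps power2_eq_square)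
  qed
  have H_hol: "H holomorphic_on - {0}"
    unfolding holomorphic_on_def field_differentiable_def
    using D has_field_derivative_at_within by blast
  have Q_eq: "z * deriv H z - (m - l) * H z = Q z" if z: "z \<noteq> 0" for z
  proof -
    define F F' G G' where "F = f z" "F' = f (inverse z)" "G = g z" "G' = g (inverse z)"
    define DF' DG where "DF' = deriv f (inverse z) / z" "DG = z * deriv g z"
    note defs = \<open>F = _\<close> \<open>F' = _\<close> \<open>G = _\<close> \<open>G' = _\<close> \<open>DF' = _\<close> \<open>DG = _\<close>
    have 1: "w z * (DG - m * G) + W z / 2 * (G - G') - s / 2 * w z * G' = 0"
      using dunkl_eigen_weighted[OF g z ab s d] by (simp add: w_defs defs)
    have 2: "w z * (DF' - l * F') - W z / 2 * (F' - F) - s / 2 * w z * F = 0"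
    proof -
      have "inverse z * deriv f (inverse z) = DF'" by (simp add: defs divide_inverse mult.commute)
      then show ?thesis
        using dunkl_eigen_weighted[OF f _ ab s d, of "inverse z"] z
        by (simp add: w_defs defs(1-4) jacobi_weight_inverse jacobi_weight_theta_inverse)
    qed
    have "z * deriv H z = - DF' * G * w z + F' * DG * w z + F' * G * (z * deriv w z)"
      unfolding DERIV_imp_deriv[OF D[OF z]] defs using z
      by (simp add: field_simps power2_eq_square)
    also have "z * deriv w z = W z"
      using deriv_jacobi_weight[OF z] by (simp add: w_defs)
    finally have 3: "z * deriv H z = - DF' * G * w z + F' * DG * w z + F' * G * W z" .
    have 4: "H z = F' * G * w z"
        "Q z = W z / 2 * (F' * G' + F * G) + s / 2 * w z * (F' * G' - F * G)"
      by (simp_all add: H_def Q_def defs(1-4))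
    have "z * deriv H z - (m - l) * H z - Q z =
        F' * (w z * (DG - m * G) + W z / 2 * (G - G') - s / 2 * w z * G')
        - G * (w z * (DF' - l * F') - W z / 2 * (F' - F) - s / 2 * w z * F)"
      unfolding 3 4 by (simp add: field_simps)
    then show ?thesis unfolding 1 2 by simp
  qed
  have sub: "sphere 0 1 \<subseteq> - {0 :: complex}" by auto
  have cont: "continuous_on (sphere 0 1) (\<lambda>z. (m - l) * H z)"
      "continuous_on (sphere 0 1) (\<lambda>z. z * deriv H z)"
    using holomorphic_on_imp_continuous_on[OF H_hol]
      holomorphic_on_imp_continuous_on[OF holomorphic_deriv[OF H_hol]]
    by (auto intro!: continuous_intros intro: continuous_on_subset[OF _ sub])
  \<comment> \<open>expressing \<open>Q\<close> by \<open>H\<close> provides the continuity that splitting the mean requires\<close>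
  have "0 = circle_mean Q"
    by (rule circle_mean_eq_0_if_odd[symmetric])
       (simp add: Q_def w_defs jacobi_weight_inverse jacobi_weight_theta_inverse algebra_simps)
  also have "circle_mean Q = circle_mean (\<lambda>z. z * deriv H z - (m - l) * H z)"
    by (rule circle_mean_cong, rule Q_eq[symmetric]) auto
  also have "\<dots> = - (m - l) * circle_mean H"
    by (simp only: circle_mean_diff[OF cont(2,1)] circle_mean_theta[OF H_hol]
        circle_mean_cmult[of "m - l" H]) (simp add: algebra_simps)
  finally show ?thesis using lm by (simp add: H_def w_defs)
qed

section \<open>The total mass of the weight\<close>

lemma continuous_jacobi_weight: "continuous_on (sphere 0 1) (jacobi_weight a b)"
  using holomorphic_on_imp_continuous_on[OF jacobi_weight_holomorphic]
  by (rule continuous_on_subset) auto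

text \<open>
  The mean of \<open>\<theta>((z - 1/z) \<delta>)\<close> vanishes, and the factor \<open>z - 1/z\<close> is what the Pearson equation
  needs to express this function through \<open>\<delta>\<close> itself.
\<close>
lemma first_moment_jacobi_weight:
  "(of_nat a + of_nat b + 1) * circle_mean (\<lambda>z. (z + inverse z) * jacobi_weight a b z) +
   2 * (of_nat a - of_nat b) * circle_mean (jacobi_weight a b) = 0"
proof -
  define w W where "w = jacobi_weight a b" "W = jacobi_weight_theta a b"
  note w_defs = this
  define s d :: complex where "s = of_nat a + of_nat b" "d = of_nat a - of_nat b"
  note sd = this
  define U where "U = (\<lambda>z. (z - inverse z) * w z)"
  have U_hol: "U holomorphic_on - {0}"
    unfolding U_def w_defs by (intro holomorphic_intros) auto
  have eq: "z * deriv U z = (s + 1) * ((z + inverse z) * w z) + 2 * d * w z" if z: "z \<noteq> 0" for z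
  proof -
    have "(w has_field_derivative deriv w z) (at z)"
      unfolding w_defs using z by (auto intro!: holomorphic_derivI[OF jacobi_weight_holomorphic])
    then have "(U has_field_derivative (1 + inverse z / z) * w z + (z - inverse z) * deriv w z) (at z)"
      unfolding U_def using z by (auto intro!: derivative_eq_intros simp: field_simps power2_eq_square)
    from DERIV_imp_deriv[OF this]
    have "z * deriv U z = (z + inverse z) * w z + (z - inverse z) * (z * deriv w z)"
      using z by (simp add: field_simps)
    also have "z * deriv w z = W z"
      using deriv_jacobi_weight[OF z] by (simp add: w_defs)
    also have "(z - inverse z) * W z = inverse z * ((z\<^sup>2 - 1) * W z)"
      using z by (simp add: field_simps power2_eq_square)
    also have "\<dots> = inverse z * ((s * z\<^sup>2 + 2 * d * z + s) * w z)"
      using pearson_equation[OF z sd] by (simp only: w_defs)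
    also have "(z + inverse z) * w z + \<dots> = (s + 1) * ((z + inverse z) * w z) + 2 * d * w z"
      using z by (simp add: field_simps power2_eq_square)
    finally show ?thesis .
  qed
  have w_cont: "continuous_on (sphere 0 1) w"
    using continuous_jacobi_weight by (simp add: w_defs)
  have "0 = circle_mean (\<lambda>z. z * deriv U z)"
    by (rule circle_mean_theta[OF U_hol, symmetric])
  also have "\<dots> = circle_mean (\<lambda>z. (s + 1) * ((z + inverse z) * w z) + 2 * d * w z)"
    by (rule circle_mean_cong, rule eq) auto
  also have "\<dots> = circle_mean (\<lambda>z. (s + 1) * ((z + inverse z) * w z)) + circle_mean (\<lambda>z. 2 * d * w z)"
    by (intro circle_mean_add continuous_intros w_cont) auto
  finally show ?thesis
    using circle_mean_cmult[of "s + 1" "\<lambda>z. (z + inverse z) * w z"] circle_mean_cmult[of "2 * d" w]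
    by (simp add: sd w_defs)
qed

lemma circle_mean_jacobi_weight_Suc:
  "(of_nat a + of_nat b + 1) * circle_mean (jacobi_weight (Suc a) b) =
     2 * (2 * of_nat a + 1) * circle_mean (jacobi_weight a b)" (is ?th1)
  "(of_nat a + of_nat b + 1) * circle_mean (jacobi_weight a (Suc b)) =
     2 * (2 * of_nat b + 1) * circle_mean (jacobi_weight a b)" (is ?th2)
proof -
  define w where "w = jacobi_weight a b"
  define M where "M = circle_mean (\<lambda>z. (z + inverse z) * w z)"
  have w_cont: "continuous_on (sphere 0 1) w"
    using continuous_jacobi_weight by (simp add: w_def)
  have cont: "continuous_on (sphere 0 1) (\<lambda>z. 2 * w z)"
      "continuous_on (sphere 0 1) (\<lambda>z. (z + inverse z) * w z)"
    by (intro continuous_intros w_cont; auto)+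
  have "circle_mean (jacobi_weight (Suc a) b) = circle_mean (\<lambda>z. 2 * w z - (z + inverse z) * w z)"
    by (intro circle_mean_cong) (simp add: jacobi_weight_def w_def algebra_simps)
  also have "\<dots> = 2 * circle_mean w - M"
    unfolding M_def by (simp only: circle_mean_diff[OF cont] circle_mean_cmult[of 2 w])
  finally have 1: "circle_mean (jacobi_weight (Suc a) b) = 2 * circle_mean w - M" .
  have "circle_mean (jacobi_weight a (Suc b)) = circle_mean (\<lambda>z. 2 * w z + (z + inverse z) * w z)"
    by (intro circle_mean_cong) (simp add: jacobi_weight_def w_def algebra_simps)
  also have "\<dots> = 2 * circle_mean w + M"
    unfolding M_def by (simp only: circle_mean_add[OF cont] circle_mean_cmult[of 2 w])
  finally have 2: "circle_mean (jacobi_weight a (Suc b)) = 2 * circle_mean w + M" .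
  have 3: "(of_nat a + of_nat b + 1) * M + 2 * (of_nat a - of_nat b) * circle_mean w = 0"
    using first_moment_jacobi_weight[of a b] by (simp add: M_def w_def)
  show ?th1 unfolding 1 w_def[symmetric] using 3 by algebra
  show ?th2 unfolding 2 w_def[symmetric] using 3 by algebra
qed

text \<open>
  The duplication formula would give \<open>4\<^sup>a\<^sup>+\<^sup>b \<Gamma>(a + 1/2) \<Gamma>(b + 1/2) / (\<pi> \<Gamma>(a + b + 1))\<close>. The form chosen
  here is the one in which the mass appears as a quotient of \<open>c\<close>-functions.
\<close>
definition weight_mass :: "nat \<Rightarrow> nat \<Rightarrow> real" where
  "weight_mass a b = Gamma (real a + 1/2) * Gamma (real b + 1/2) * Gamma (real a + real b + 1) /
     (Gamma ((real a + real b) / 2 + 1/2) * Gamma ((real a + real b) / 2 + 1))\<^sup>2"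

lemma Gamma_real_Suc: "(x :: real) > 0 \<Longrightarrow> Gamma (x + 1) = x * Gamma x"
  by (rule Gamma_plus1) (auto elim!: nonpos_Ints_cases)

lemma weight_mass_pos: "weight_mass a b > 0"
  unfolding weight_mass_def by (intro divide_pos_pos mult_pos_pos zero_less_power Gamma_real_pos)
    (auto intro!: add_nonneg_pos)

lemma weight_mass_commute: "weight_mass a b = weight_mass b a"
  by (simp add: weight_mass_def ac_simps)

text \<open>
  Increasing \<open>a\<close> by one shifts the argument \<open>(a + b)/2\<close> by one half, which merely exchanges the two
  Gamma factors in the denominator and then raises one of them by a full step.
\<close>
lemma weight_mass_Suc:
  "(real a + real b + 1) * weight_mass (Suc a) b = 2 * (2 * real a + 1) * weight_mass a b"
proof -
  define s where "s = real a + real b"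
  have s: "s \<ge> 0" by (simp add: s_def)
  define A B C X Y where "A = Gamma (real a + 1/2)" "B = Gamma (real b + 1/2)" "C = Gamma (s + 1)"
    "X = Gamma (s / 2 + 1/2)" "Y = Gamma (s / 2 + 1)"
  note defs = this
  have pos: "X > 0" "Y > 0" using s by (auto simp: defs intro!: Gamma_real_pos)
  have A: "Gamma (real (Suc a) + 1/2) = (real a + 1/2) * A"
    using Gamma_real_Suc[of "real a + 1/2"] by (simp add: defs algebra_simps)
  have C: "Gamma (real (Suc a) + real b + 1) = (s + 1) * C"
    using Gamma_real_Suc[of "s + 1"] s by (simp add: defs s_def algebra_simps)
  have X: "Gamma ((real (Suc a) + real b) / 2 + 1/2) = Y"
    by (simp add: defs s_def field_simps)
  have Y: "Gamma ((real (Suc a) + real b) / 2 + 1) = (s / 2 + 1/2) * X"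
    using Gamma_real_Suc[of "s / 2 + 1/2"] s by (simp add: defs s_def field_simps)
  have "weight_mass a b = A * B * C / (X * Y)\<^sup>2"
    by (simp add: weight_mass_def defs s_def)
  moreover have "weight_mass (Suc a) b =
      ((real a + 1/2) * A) * B * ((s + 1) * C) / (Y * ((s / 2 + 1/2) * X))\<^sup>2"
    unfolding weight_mass_def A C X Y by (simp add: defs)
  moreover have "(s + 1) * (((real a + 1/2) * A) * B * ((s + 1) * C) / (Y * ((s / 2 + 1/2) * X))\<^sup>2) =
      2 * (2 * real a + 1) * (A * B * C / (X * Y)\<^sup>2)"
  proof -
    define t where "t = s / 2 + 1/2"
    have t: "t > 0" "s + 1 = 2 * t" using s by (auto simp: t_def)
    show ?thesis unfolding t_def[symmetric] t(2) using t(1) pos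
      by (simp add: field_simps power2_eq_square)
  qed
  ultimately show ?thesis by (simp add: s_def)
qed

theorem circle_mean_jacobi_weight: "circle_mean (jacobi_weight a b) = of_real (weight_mass a b)"
proof -
  have b: "circle_mean (jacobi_weight 0 b) = of_real (weight_mass 0 b)" for b
  proof (induction b)
    case 0
    show ?case
      by (simp add: circle_mean_def jacobi_weight_def weight_mass_def Gamma_one_half_real)
  next
    case (Suc b)
    have "complex_of_real ((real 0 + real b + 1) * weight_mass 0 (Suc b)) =
        of_real (2 * (2 * real b + 1) * weight_mass 0 b)"
      using weight_mass_Suc[of b 0] by (simp only: weight_mass_commute[of 0] add.commute)
    then have "(of_nat b + 1) * circle_mean (jacobi_weight 0 (Suc b)) =
        (of_nat b + 1) * of_real (weight_mass 0 (Suc b))"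
      using circle_mean_jacobi_weight_Suc(2)[of 0 b] Suc.IH by simp
    moreover have "(of_nat b + 1 :: complex) \<noteq> 0" by (metis of_nat_Suc of_nat_neq_0 add.commute)
    ultimately show ?case using mult_left_cancel by blast
  qed
  show ?thesis
  proof (induction a)
    case 0
    show ?case by (rule b)
  next
    case (Suc a)
    have "complex_of_real ((real a + real b + 1) * weight_mass (Suc a) b) =
        of_real (2 * (2 * real a + 1) * weight_mass a b)"
      by (simp only: weight_mass_Suc)
    then have "(of_nat a + of_nat b + 1) * circle_mean (jacobi_weight (Suc a) b) =
        (of_nat a + of_nat b + 1) * of_real (weight_mass (Suc a) b)"
      using circle_mean_jacobi_weight_Suc(1)[of a b] Suc.IH by simp
    moreover have "(of_nat a + of_nat b + 1 :: complex) \<noteq> 0"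
      by (metis of_nat_Suc of_nat_neq_0 of_nat_add add.commute)
    ultimately show ?case using mult_left_cancel by blast
  qed
qed

section \<open>The polynomials as iterated intertwiners\<close>

text \<open>
  The multiples from the two intertwining lemmas, for the eigenvalue belonging to index \<open>j - 1\<close>.
  Up to sign they are the Verblunsky coefficients of the weight on the circle.
\<close>
definition recursion_coeff :: "nat \<Rightarrow> nat \<Rightarrow> nat \<Rightarrow> real" where
  "recursion_coeff a b j =
     (if odd j then real a - real b else real a + real b) / (real j + real a + real b)"

primrec jacobi_poly :: "nat \<Rightarrow> nat \<Rightarrow> nat \<Rightarrow> laurent_poly" where
  "jacobi_poly a b 0 = 1"
| "jacobi_poly a b (Suc j) =
     laurent_reflect (if even j then 1 else 0) (jacobi_poly a b j) +
     laurent_const (of_real (recursion_coeff a b (Suc j))) * jacobi_poly a b j"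

text \<open>
  In terms of the exponent \<open>n\<close> of the leading monomial this is \<open>n - \<rho>\<close> for \<open>n \<le> 0\<close> (even \<open>j\<close>)
  and \<open>n + \<rho>\<close> for \<open>n > 0\<close> (odd \<open>j\<close>).
\<close>
definition jacobi_eigenvalue :: "nat \<Rightarrow> nat \<Rightarrow> nat \<Rightarrow> real" where
  "jacobi_eigenvalue a b j =
     (if even j then - (real j + real a + real b) / 2 else (real j + real a + real b + 1) / 2)"

lemma jacobi_poly_eigen:
  assumes "b \<ge> 1"
  shows "dunkl_eigen (of_nat a + of_nat b) (of_nat a - of_nat b)
    (of_real (jacobi_eigenvalue a b j)) (laurent_eval (jacobi_poly a b j))"
proof (induction j)
  case 0
  have "dunkl_eigen (of_nat a + of_nat b) (of_nat a - of_nat b)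
      (- (of_nat a + of_nat b) / 2) (laurent_eval (jacobi_poly a b 0))"
    by (rule dunkl_eigen_cong[OF dunkl_eigen_one]) (simp add: laurent_eval_one)
  then show ?case by (simp add: jacobi_eigenvalue_def)
next
  case (Suc j)
  define l where "l = jacobi_eigenvalue a b j"
  define f where "f = laurent_eval (jacobi_poly a b j)"
  have IH: "dunkl_eigen (of_nat a + of_nat b) (of_nat a - of_nat b) (of_real l) f"
    using Suc.IH by (simp add: l_def f_def)
  have eval: "laurent_eval (jacobi_poly a b (Suc j)) z =
      z powi (if even j then 1 else 0) * f (inverse z) + of_real (recursion_coeff a b (Suc j)) * f z"
    if "z \<noteq> 0" for z
    using that by (simp add: laurent_eval_add laurent_eval_scale laurent_eval_reflect f_def)
  show ?case
  proof (cases "even j")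
    case True
    have l: "1 - 2 * l = real (Suc j) + real a + real b" "1 - l = jacobi_eigenvalue a b (Suc j)"
      using True by (auto simp: l_def jacobi_eigenvalue_def field_simps)
    have "1 - 2 * l \<noteq> 0" unfolding l(1) by simp
    then have nz: "1 - 2 * complex_of_real l \<noteq> 0"
      by (metis of_real_1 of_real_diff of_real_eq_0_iff of_real_mult of_real_numeral)
    have "recursion_coeff a b (Suc j) = (real a - real b) / (1 - 2 * l)"
      unfolding l(1) using True by (simp add: recursion_coeff_def)
    then have c: "complex_of_real (recursion_coeff a b (Suc j)) =
        (of_nat a - of_nat b) / (1 - 2 * of_real l)" by simp
    show ?thesis
      unfolding l(2)[symmetric] of_real_diff of_real_1
      by (rule dunkl_eigen_cong[OF dunkl_eigen_intertwine_affine[OF IH nz]])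
         (simp add: eval True c del: jacobi_poly.simps)
  next
    case False
    have l: "2 * l = real (Suc j) + real a + real b" "- l = jacobi_eigenvalue a b (Suc j)"
      using False by (auto simp: l_def jacobi_eigenvalue_def field_simps)
    have "2 * l \<noteq> 0" unfolding l(1) by simp
    then have nz: "complex_of_real l \<noteq> 0" by simp
    have "recursion_coeff a b (Suc j) = (real a + real b) / (2 * l)"
      unfolding l(1) using False by (simp add: recursion_coeff_def)
    then have c: "complex_of_real (recursion_coeff a b (Suc j)) =
        (of_nat a + of_nat b) / (2 * of_real l)" by simp
    show ?thesis
      unfolding l(2)[symmetric] of_real_minus
      by (rule dunkl_eigen_cong[OF dunkl_eigen_intertwine_s[OF IH nz]])
         (simp add: eval False c del: jacobi_poly.simps)
  qed
qed

lemma jacobi_eigenvalue_inj: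
  assumes "b \<ge> 1" "jacobi_eigenvalue a b i = jacobi_eigenvalue a b j"
  shows "i = j"
  using assms by (auto simp: jacobi_eigenvalue_def split: if_splits)

lemma real_coeffs_jacobi_poly: "real_coeffs (jacobi_poly a b j)"
proof (induction j)
  case 0
  show ?case by (simp add: real_coeffs_def lookup_one when_def)
next
  case (Suc j)
  then show ?case
    by (auto simp: real_coeffs_def lookup_add lookup_scale lookup_laurent_reflect)
qed

lemma basis_position_reflect:
  "basis_position (- n) = (if n = 0 then 0 else if n > 0 then basis_position n + 1 else basis_position n - 1)"
  "basis_position (1 - n) = (if n > 0 then basis_position n - 1 else basis_position n + 1)"
  by (auto simp: basis_position_def nat_eq_iff)

text \<open>
  The reflection used at step \<open>j\<close> exchanges the exponents at positions \<open>j\<close> and \<open>j + 1\<close> and moves no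
  position by more than one. Hence it carries the leading monomial of one polynomial to that of
  the next and creates nothing beyond it.
\<close>
lemma jacobi_poly_leading:
  "(\<forall>n. basis_position n > j \<longrightarrow> Poly_Mapping.lookup (jacobi_poly a b j) n = 0) \<and>
   Poly_Mapping.lookup (jacobi_poly a b j) (basis_exponent j) = 1"
proof (induction j)
  case 0
  show ?case by (auto simp: lookup_one when_def basis_position_def basis_exponent_def)
next
  case (Suc j)
  define c :: int where "c = (if even j then 1 else 0)"
  have pos: "basis_position (c - n) \<ge> basis_position n - 1" for n
    by (cases "n = 0") (auto simp: c_def basis_position_reflect basis_position_def[of 0])
  have exp: "c - basis_exponent (Suc j) = basis_exponent j"
    by (auto simp: c_def basis_exponent_def elim!: evenE oddE)
  have look: "Poly_Mapping.lookup (jacobi_poly a b (Suc j)) n =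
      Poly_Mapping.lookup (jacobi_poly a b j) (c - n) +
      of_real (recursion_coeff a b (Suc j)) * Poly_Mapping.lookup (jacobi_poly a b j) n" for n
    by (simp add: lookup_add lookup_scale lookup_laurent_reflect c_def)
  show ?case
  proof (intro conjI allI impI)
    fix n assume n: "basis_position n > Suc j"
    then have "basis_position (c - n) > j" using pos[of n] by linarith
    then show "Poly_Mapping.lookup (jacobi_poly a b (Suc j)) n = 0"
      using Suc.IH n by (simp add: look del: jacobi_poly.simps)
  next
    have "basis_position (basis_exponent (Suc j)) > j" by simp
    then show "Poly_Mapping.lookup (jacobi_poly a b (Suc j)) (basis_exponent (Suc j)) = 1"
      using Suc.IH by (simp add: look exp del: jacobi_poly.simps)
  qed
qed

lemma jacobi_poly_spans:
  assumes "\<And>n. basis_position n \<ge> j \<Longrightarrow> Poly_Mapping.lookup f n = 0"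
  shows "\<exists>\<mu>. f = (\<Sum>i<j. laurent_const (\<mu> i) * jacobi_poly a b i)"
  using assms
proof (induction j arbitrary: f)
  case 0
  then have "f = 0" by (intro poly_mapping_eqI) simp
  then show ?case by simp
next
  case (Suc j)
  define c where "c = Poly_Mapping.lookup f (basis_exponent j)"
  have "Poly_Mapping.lookup (f - laurent_const c * jacobi_poly a b j) n = 0"
    if n: "basis_position n \<ge> j" for n
  proof (cases "basis_position n = j")
    case True
    then have "n = basis_exponent j" by (metis basis_exponent_position)
    then show ?thesis
      using jacobi_poly_leading[of j a b] by (simp add: lookup_minus lookup_scale c_def)
  next
    case False
    then show ?thesis
      using jacobi_poly_leading[of j a b] Suc.prems[of n] n by (simp add: lookup_minus lookup_scale)
  qed
  from Suc.IH[OF this] obtain \<mu> where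
    "f - laurent_const c * jacobi_poly a b j = (\<Sum>i<j. laurent_const (\<mu> i) * jacobi_poly a b i)" by blast
  then have "f = (\<Sum>i<Suc j. laurent_const ((\<mu>(j := c)) i) * jacobi_poly a b i)"
    by (simp add: algebra_simps)
  then show ?case by blast
qed

section \<open>The inner product\<close>

lemma weight_eq_jacobi_weight:
  assumes "z \<noteq> 0" "b \<le> a"
  shows "weight (int a - int b, int b) z = jacobi_weight a b z"
proof -
  have 1: "2 - z powi 2 - z powi - 2 = (2 - z - inverse z) * (2 + z + inverse z)"
  proof -
    have "z * inverse z = 1" using assms(1) by simp
    moreover have "z powi 2 = z\<^sup>2" "z powi - 2 = (inverse z)\<^sup>2"
      by (simp_all add: power_int_minus power_inverse)
    ultimately show ?thesis by algebra
  qed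
  have 2: "int a - int b = int (a - b)" using assms(2) by simp
  have 3: "z powi - 1 = inverse z" by (simp add: power_int_minus)
  have "weight (int a - int b, int b) z =
      (2 - z - inverse z) ^ (a - b) * ((2 - z - inverse z) * (2 + z + inverse z)) ^ b"
    unfolding weight_def fst_conv snd_conv 1 2 3 power_int_of_nat ..
  also have "\<dots> = (2 - z - inverse z) ^ (a - b + b) * (2 + z + inverse z) ^ b"
    by (simp only: power_add power_mult_distrib mult.assoc)
  finally show ?thesis using assms(2) by (simp add: jacobi_weight_def)
qed

text \<open>
  The bilinear version of the inner product: on the circle, \<open>f(1/z)\<close> is the complex conjugate of
  \<open>f(z)\<close> when \<open>f\<close> has real coefficients.
\<close>
definition jacobi_form :: "nat \<Rightarrow> nat \<Rightarrow> laurent_poly \<Rightarrow> laurent_poly \<Rightarrow> complex" where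
  "jacobi_form a b f g =
     circle_mean (\<lambda>z. laurent_eval f (inverse z) * laurent_eval g z * jacobi_weight a b z)"

lemma jacobi_inner_eq_form:
  assumes "real_coeffs f" "b \<le> a"
  shows "jacobi_inner (int a - int b, int b) f g = jacobi_form a b f g"
  unfolding jacobi_inner_def contour_integral_circlepath_eq_mean jacobi_form_def
  by (rule circle_mean_cong, subst weight_eq_jacobi_weight)
     (use assms in \<open>auto simp: cnj_laurent_eval\<close>)

lemma jacobi_form_commute: "jacobi_form a b f g = jacobi_form a b g f"
  unfolding jacobi_form_def
  by (subst circle_mean_inverse[symmetric]) (simp add: jacobi_weight_inverse mult_ac)

lemma continuous_laurent_eval:
  "continuous_on (sphere 0 1) (laurent_eval f)"
  "continuous_on (sphere 0 1) (\<lambda>z. laurent_eval f (inverse z))"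
proof -
  have *: "continuous_on (- {0}) (laurent_eval f)"
    by (rule holomorphic_on_imp_continuous_on[OF laurent_eval_holomorphic])
  show "continuous_on (sphere 0 1) (laurent_eval f)"
    by (rule continuous_on_subset[OF *]) auto
  show "continuous_on (sphere 0 1) (\<lambda>z. laurent_eval f (inverse z))"
    by (rule continuous_on_compose2[OF *]) (auto intro!: continuous_intros)
qed

lemma jacobi_form_add: "jacobi_form a b f (g + h) = jacobi_form a b f g + jacobi_form a b f h"
proof -
  have "continuous_on (sphere 0 1) (\<lambda>z. laurent_eval f (inverse z) * laurent_eval g z * jacobi_weight a b z)"
    for g
    by (intro continuous_intros continuous_laurent_eval continuous_jacobi_weight)
  from circle_mean_add[OF this this, of g h] show ?thesis
    by (simp add: jacobi_form_def laurent_eval_add algebra_simps)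
qed

lemma jacobi_form_scale: "jacobi_form a b f (laurent_const c * g) = c * jacobi_form a b f g"
  unfolding jacobi_form_def circle_mean_cmult[symmetric]
  by (intro circle_mean_cong) (subst laurent_eval_scale, simp add: mult_ac)

lemma jacobi_form_sum:
  "finite A \<Longrightarrow> jacobi_form a b f (\<Sum>i\<in>A. g i) = (\<Sum>i\<in>A. jacobi_form a b f (g i))"
proof (induction A rule: finite_induct)
  case empty
  then show ?case using jacobi_form_scale[of a b f 0 0] by simp
next
  case (insert x A)
  then show ?case by (simp add: jacobi_form_add)
qed

lemma jacobi_form_reflect:
  "jacobi_form a b (laurent_reflect c f) (laurent_reflect c g) = jacobi_form a b f g"
proof -
  have "jacobi_form a b (laurent_reflect c f) (laurent_reflect c g) =
      circle_mean (\<lambda>z. laurent_eval f (inverse (inverse z)) * laurent_eval g (inverse z) *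
        jacobi_weight a b (inverse z))"
    unfolding jacobi_form_def
  proof (rule circle_mean_cong)
    fix z :: complex assume "norm z = 1"
    then have "z \<noteq> 0" by auto
    then show "laurent_eval (laurent_reflect c f) (inverse z) * laurent_eval (laurent_reflect c g) z *
        jacobi_weight a b z = laurent_eval f (inverse (inverse z)) * laurent_eval g (inverse z) *
        jacobi_weight a b (inverse z)"
      by (simp add: laurent_eval_reflect jacobi_weight_inverse power_int_inverse)
  qed
  also have "\<dots> = jacobi_form a b f g"
    unfolding jacobi_form_def by (rule circle_mean_inverse)
  finally show ?thesis .
qed

lemma jacobi_form_orthogonal:
  assumes "a \<ge> 1" "b \<ge> 1" "i \<noteq> j"
  shows "jacobi_form a b (jacobi_poly a b i) (jacobi_poly a b j) = 0"
  unfolding jacobi_form_def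
proof (rule dunkl_eigen_orthogonal[OF jacobi_poly_eigen jacobi_poly_eigen])
  show "complex_of_real (jacobi_eigenvalue a b i) \<noteq> of_real (jacobi_eigenvalue a b j)"
    using assms jacobi_eigenvalue_inj by auto
qed (use assms in auto)

section \<open>Norms and the Gram--Schmidt process\<close>

definition jacobi_poly_norm :: "nat \<Rightarrow> nat \<Rightarrow> nat \<Rightarrow> real" where
  "jacobi_poly_norm a b j = weight_mass a b * (\<Prod>i=1..j. 1 - (recursion_coeff a b i)\<^sup>2)"

text \<open>
  Pythagoras in the triangle formed by \<open>F\<^sub>j\<^sub>+\<^sub>1\<close>, the reflection \<open>R\<close> of \<open>F\<^sub>j\<close>, and \<open>\<gamma> F\<^sub>j\<close>: the vectors
  \<open>F\<^sub>j\<^sub>+\<^sub>1\<close> and \<open>F\<^sub>j\<close> are orthogonal, and \<open>R\<close> has the length of \<open>F\<^sub>j\<close>.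
\<close>
theorem jacobi_form_jacobi_poly:
  assumes "a \<ge> 1" "b \<ge> 1"
  shows "jacobi_form a b (jacobi_poly a b j) (jacobi_poly a b j) = of_real (jacobi_poly_norm a b j)"
proof (induction j)
  case 0
  have "jacobi_form a b (jacobi_poly a b 0) (jacobi_poly a b 0) = circle_mean (jacobi_weight a b)"
    unfolding jacobi_form_def
    by (rule circle_mean_cong) (simp add: laurent_eval_one)
  then show ?case by (simp add: circle_mean_jacobi_weight jacobi_poly_norm_def)
next
  case (Suc j)
  define F F' R where "F = jacobi_poly a b j" "F' = jacobi_poly a b (Suc j)"
    "R = laurent_reflect (if even j then 1 else 0) F"
  note defs = this
  define g where "g = complex_of_real (recursion_coeff a b (Suc j))"
  define B where "B = jacobi_form a b"
  have F': "F' = R + laurent_const g * F" by (simp add: defs g_def)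
  have lin: "B h F' = B h R + g * B h F" for h
    by (simp add: F' B_def jacobi_form_add jacobi_form_scale)
  have orth: "B F F' = 0" "B F' F = 0"
    using jacobi_form_orthogonal[OF assms, of j "Suc j"] jacobi_form_orthogonal[OF assms, of "Suc j" j]
    by (simp_all add: B_def defs)
  have N: "B R R = B F F" by (simp add: B_def defs jacobi_form_reflect)
  have "B F' F' = B F' R" using lin[of F'] orth by simp
  also have "\<dots> = B R F'" by (simp add: B_def jacobi_form_commute)
  also have "\<dots> = B F F + g * B F R" using lin[of R] N by (simp add: B_def jacobi_form_commute)
  also have "B F R = - g * B F F" using lin[of F] orth by (simp add: add_eq_0_iff)
  finally have "B F' F' = B F F * (1 - g\<^sup>2)" by (simp add: algebra_simps power2_eq_square)
  moreover have "B F F = of_real (jacobi_poly_norm a b j)" using Suc.IH by (simp add: B_def defs)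
  ultimately have "B F' F' = of_real (jacobi_poly_norm a b (Suc j))"
    by (simp add: jacobi_poly_norm_def g_def mult.assoc)
  then show ?case by (simp only: B_def defs)
qed

lemma recursion_coeff_square_less_1:
  assumes "a \<ge> 1" "b \<ge> 1" "j \<ge> 1"
  shows "(recursion_coeff a b j)\<^sup>2 < 1"
proof -
  have "\<bar>recursion_coeff a b j\<bar> < 1"
    using assms by (auto simp: recursion_coeff_def abs_if field_simps)
  then show ?thesis by (simp add: abs_square_less_1)
qed

lemma jacobi_poly_norm_pos:
  assumes "a \<ge> 1" "b \<ge> 1"
  shows "jacobi_poly_norm a b j > 0"
  unfolding jacobi_poly_norm_def using recursion_coeff_square_less_1[OF assms]
  by (intro mult_pos_pos weight_mass_pos prod_pos) auto

text \<open>
  The \<open>j\<close>-th monomial differs from the \<open>j\<close>-th polynomial by a combination of the earlier ones, and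
  by orthogonality the coefficients of this combination are the ones used by Gram--Schmidt. Dividing
  by the norms is legitimate because they are positive.
\<close>
theorem jacobi_gs_eq_jacobi_poly:
  assumes "1 \<le> b" "b \<le> a"
  shows "jacobi_gs (int a - int b, int b) j = jacobi_poly a b j"
proof (induction j rule: less_induct)
  case (less j)
  define k where "k = (int a - int b, int b)"
  define e where "e = laurent_monom (basis_exponent j)"
  define F where "F = jacobi_poly a b"
  define B where "B = jacobi_form a b"
  have a: "1 \<le> a" using assms by simp
  have "\<exists>\<mu>. e - F j = (\<Sum>i<j. laurent_const (\<mu> i) * F i)"
    unfolding F_def
  proof (rule jacobi_poly_spans)
    fix n assume n: "j \<le> basis_position n"
    show "Poly_Mapping.lookup (e - jacobi_poly a b j) n = 0"
    proof (cases "basis_position n = j")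
      case True
      then have "n = basis_exponent j" by (metis basis_exponent_position)
      then show ?thesis using jacobi_poly_leading[of j a b] by (simp add: e_def lookup_minus)
    next
      case False
      then have "basis_exponent j \<noteq> n" by (metis basis_position_exponent)
      then show ?thesis using False n jacobi_poly_leading[of j a b]
        by (simp add: e_def lookup_minus lookup_single)
    qed
  qed
  then obtain \<mu> where "e - F j = (\<Sum>i<j. laurent_const (\<mu> i) * F i)" by blast
  then have e: "e = F j + (\<Sum>i<j. laurent_const (\<mu> i) * F i)" by (simp add: algebra_simps)
  have coeff: "jacobi_inner k (F i) e / jacobi_inner k (F i) (F i) = \<mu> i" if i: "i < j" for i
  proof -
    have inner: "jacobi_inner k (F i) h = B (F i) h" for h
      using assms jacobi_inner_eq_form[OF real_coeffs_jacobi_poly] by (simp add: k_def F_def B_def)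
    have orth: "B (F i) (F l) = (if i = l then of_real (jacobi_poly_norm a b i) else 0)" for l
      using jacobi_form_orthogonal[OF a assms(1), of i l] jacobi_form_jacobi_poly[OF a assms(1), of i]
      by (auto simp: B_def F_def)
    have "B (F i) e = (\<Sum>l<j. \<mu> l * B (F i) (F l))"
      using i orth[of j] unfolding e B_def
      by (simp add: jacobi_form_add jacobi_form_sum jacobi_form_scale)
    also have "\<dots> = \<mu> i * of_real (jacobi_poly_norm a b i)"
      using i by (simp add: orth if_distrib cong: if_cong)
    finally show ?thesis
      using jacobi_poly_norm_pos[OF a assms(1), of i] by (simp add: inner orth)
  qed
  have "jacobi_gs k j = e - (\<Sum>i<j. laurent_const
      (jacobi_inner k (jacobi_gs k i) e / jacobi_inner k (jacobi_gs k i) (jacobi_gs k i)) * jacobi_gs k i)"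
    unfolding e_def by (rule jacobi_gs.simps)
  also have "\<dots> = e - (\<Sum>i<j. laurent_const (\<mu> i) * F i)"
    using less.IH coeff by (simp add: k_def F_def)
  also have "\<dots> = F j" using e by (simp add: algebra_simps)
  finally show ?case by (simp add: k_def F_def)
qed

section \<open>The norms in terms of the c-functions\<close>

definition c_quotient :: "weyl \<Rightarrow> int \<Rightarrow> int \<Rightarrow> real \<Rightarrow> real" where
  "c_quotient w k1 k2 t = c_star w (- t) (k1, k2) / c_tilde w t (k1, k2)"

lemma c_quotient_eq:
  fixes a b :: nat and s t :: real
  defines "s \<equiv> real a + real b"
  shows "c_quotient Weyl_1 (int a - int b) (int b) (t + s / 2) =
      Gamma (t + real b + 1/2) * Gamma t * Gamma (t + real a + 1/2) * Gamma (t + s) /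
      (Gamma (t + s / 2) * Gamma (t + s / 2 + 1/2))\<^sup>2"
    and "c_quotient Weyl_s (int a - int b) (int b) (t + s / 2) =
      Gamma (t + real b + 1/2) * Gamma (t + 1) * Gamma (t + real a + 1/2) * Gamma (t + s + 1) /
      (Gamma (t + s / 2 + 1/2) * Gamma (t + s / 2 + 1))\<^sup>2"
proof -
  have e: "t + s / 2 - real_of_int (int a - int b) / 2 = t + real b"
    "t + real b - real_of_int (int b) = t"
    "t + s / 2 + real_of_int (int a - int b) / 2 = t + real a"
    "t + real a + real_of_int (int b) = t + s"
    by (simp_all add: s_def field_simps)
  have c: "(2 :: real) powi (int a - int b) \<noteq> 0" by simp
  show "c_quotient Weyl_1 (int a - int b) (int b) (t + s / 2) =
      Gamma (t + real b + 1/2) * Gamma t * Gamma (t + real a + 1/2) * Gamma (t + s) /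
      (Gamma (t + s / 2) * Gamma (t + s / 2 + 1/2))\<^sup>2"
    unfolding c_quotient_def c_star.simps c_tilde.simps minus_minus e
    using c by (simp add: power2_eq_square divide_simps mult_ac)
  show "c_quotient Weyl_s (int a - int b) (int b) (t + s / 2) =
      Gamma (t + real b + 1/2) * Gamma (t + 1) * Gamma (t + real a + 1/2) * Gamma (t + s + 1) /
      (Gamma (t + s / 2 + 1/2) * Gamma (t + s / 2 + 1))\<^sup>2"
    unfolding c_quotient_def c_star.simps c_tilde.simps minus_minus e
    using c by (simp add: power2_eq_square divide_simps mult_ac)
qed

lemma jacobi_poly_norm_Suc:
  "jacobi_poly_norm a b (Suc j) = jacobi_poly_norm a b j * (1 - (recursion_coeff a b (Suc j))\<^sup>2)"
  by (simp add: jacobi_poly_norm_def)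

text \<open>
  Both factors have the form \<open>1 - (v/u)\<^sup>2 = (u - v)(u + v)/u\<^sup>2\<close>. In the first case \<open>u = t + s/2\<close> and
  \<open>v = s/2\<close>, in the second \<open>u = t + s/2 + 1/2\<close> and \<open>v = (a - b)/2\<close>; the three factors are those
  which the functional equation of the Gamma function extracts from the quotients.
\<close>
lemma c_quotient_steps:
  fixes a b :: nat and s t :: real
  assumes b: "b \<ge> 1"
  defines "s \<equiv> real a + real b"
  shows "t > 0 \<Longrightarrow> c_quotient Weyl_s (int a - int b) (int b) (t + s / 2) =
      c_quotient Weyl_1 (int a - int b) (int b) (t + s / 2) * (1 - (s / (2 * t + s))\<^sup>2)" (is "_ \<Longrightarrow> ?th1")
    and "t \<ge> 0 \<Longrightarrow> c_quotient Weyl_1 (int a - int b) (int b) (t + 1 + s / 2) =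
      c_quotient Weyl_s (int a - int b) (int b) (t + s / 2) *
      (1 - ((real a - real b) / (2 * t + 1 + s))\<^sup>2)" (is "_ \<Longrightarrow> ?th2")
proof -
  have s: "s > 0" using b by (simp add: s_def)
  note quot = c_quotient_eq[of a b, folded s_def]
  {
    assume t: "t > 0"
    define A B C X Y where "A = Gamma (t + real b + 1/2)" "B = Gamma t * Gamma (t + s)"
      "C = Gamma (t + real a + 1/2)" "X = Gamma (t + s / 2)" "Y = Gamma (t + s / 2 + 1/2)"
    note defs = this
    have pos: "X > 0" "Y > 0" using s t by (auto simp: defs intro!: Gamma_real_pos)
    have G: "Gamma (t + 1) = t * Gamma t" "Gamma (t + s + 1) = (t + s) * Gamma (t + s)"
      "Gamma (t + s / 2 + 1) = (t + s / 2) * X"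
      using s t by (auto simp: defs intro!: Gamma_real_Suc)
    have "c_quotient Weyl_s (int a - int b) (int b) (t + s / 2) =
        A * B * C * (t * (t + s)) / (Y * ((t + s / 2) * X))\<^sup>2"
      unfolding quot G by (simp add: defs mult_ac)
    also have "\<dots> = A * B * C / (X * Y)\<^sup>2 * (t * (t + s) / (t + s / 2)\<^sup>2)"
      by (simp add: power_mult_distrib mult_ac)
    also have "t * (t + s) / (t + s / 2)\<^sup>2 = 1 - (s / (2 * t + s))\<^sup>2"
      using s t by (simp add: divide_simps) algebra
    also have "A * B * C / (X * Y)\<^sup>2 = c_quotient Weyl_1 (int a - int b) (int b) (t + s / 2)"
      unfolding quot by (simp add: defs mult_ac)
    finally show ?th1 .
  }
  {
    assume t: "t \<ge> 0"
    define A B C X Y where "A = Gamma (t + real b + 1/2)" "B = Gamma (t + 1) * Gamma (t + s + 1)"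
      "C = Gamma (t + real a + 1/2)" "X = Gamma (t + s / 2 + 1/2)" "Y = Gamma (t + s / 2 + 1)"
    note defs = this
    have G: "Gamma (t + 1 + real b + 1/2) = (t + real b + 1/2) * A"
      "Gamma (t + 1 + real a + 1/2) = (t + real a + 1/2) * C"
      "Gamma (t + 1 + s / 2 + 1/2) = (t + s / 2 + 1/2) * X"
      using s t Gamma_real_Suc[of "t + real b + 1/2"] Gamma_real_Suc[of "t + real a + 1/2"]
        Gamma_real_Suc[of "t + s / 2 + 1/2"] by (simp_all add: defs add_ac)
    have e: "t + 1 + s = t + s + 1" "t + 1 + s / 2 = t + s / 2 + 1" by simp_all
    have "c_quotient Weyl_1 (int a - int b) (int b) (t + 1 + s / 2) =
        A * B * C * ((t + real b + 1/2) * (t + real a + 1/2)) / (Y * ((t + s / 2 + 1/2) * X))\<^sup>2"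
      unfolding quot G unfolding e by (simp add: defs mult_ac)
    also have "\<dots> = A * B * C / (X * Y)\<^sup>2 *
        ((t + real b + 1/2) * (t + real a + 1/2) / (t + s / 2 + 1/2)\<^sup>2)"
      by (simp add: power_mult_distrib mult_ac)
    also have "(t + real b + 1/2) * (t + real a + 1/2) / (t + s / 2 + 1/2)\<^sup>2 =
        1 - ((real a - real b) / (2 * t + 1 + s))\<^sup>2"
    proof -
      define u d where "u = t + s / 2 + 1/2" "d = (real a - real b) / 2"
      note ud = this
      have u: "u > 0" using s t by (simp add: ud)
      have eqs: "t + real b + 1/2 = u - d" "t + real a + 1/2 = u + d" "real a - real b = 2 * d"
        "2 * t + 1 + s = 2 * u" by (simp_all add: ud s_def field_simps)
      show ?thesis
        unfolding eqs ud(1)[symmetric] using u by (simp add: field_simps power2_eq_square)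
    qed
    also have "A * B * C / (X * Y)\<^sup>2 = c_quotient Weyl_s (int a - int b) (int b) (t + s / 2)"
      unfolding quot by (simp add: defs mult_ac)
    finally show ?th2 .
  }
qed

theorem jacobi_poly_norm_eq_c_quotient:
  fixes a b :: nat and s :: real
  assumes b: "b \<ge> 1"
  defines "s \<equiv> real a + real b"
  shows "jacobi_poly_norm a b (2 * m) = c_quotient Weyl_s (int a - int b) (int b) (real m + s / 2)"
    and "jacobi_poly_norm a b (2 * m + 1) =
      c_quotient Weyl_1 (int a - int b) (int b) (real m + 1 + s / 2)"
proof -
  have odd: "jacobi_poly_norm a b (2 * m + 1) =
      c_quotient Weyl_1 (int a - int b) (int b) (real m + 1 + s / 2)"
    if "jacobi_poly_norm a b (2 * m) = c_quotient Weyl_s (int a - int b) (int b) (real m + s / 2)" for m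
    using that c_quotient_steps(2)[OF b, of "real m" a]
    by (simp add: jacobi_poly_norm_Suc recursion_coeff_def s_def add_ac)
  show even: "jacobi_poly_norm a b (2 * m) =
      c_quotient Weyl_s (int a - int b) (int b) (real m + s / 2)"
  proof (induction m)
    case 0
    show ?case
      using c_quotient_eq(2)[of a b 0]
      by (simp add: jacobi_poly_norm_def weight_mass_def s_def mult_ac)
  next
    case (Suc m)
    then show ?case
      using odd[OF Suc.IH] c_quotient_steps(1)[OF b, of "real m + 1" a]
      by (simp add: jacobi_poly_norm_Suc recursion_coeff_def s_def add_ac)
  qed
  show "jacobi_poly_norm a b (2 * m + 1) =
      c_quotient Weyl_1 (int a - int b) (int b) (real m + 1 + s / 2)"
    by (rule odd[OF even])
qed

theorem theorem5p6:
  fixes k1 k2 n :: int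
  assumes "even k1" and "k1 \<ge> 1" and "k2 \<ge> 1"
  shows "jacobi_norm_sq (k1, k2) (nonsym_jacobi n (k1, k2)) =
    complex_of_real
      (c_star (weyl_upper n * weyl_lower (dominant n))
         (- (real_of_int (dominant n) + rho (k1, k2))) (k1, k2) /
       c_tilde (weyl_upper n * weyl_lower (dominant n))
         (real_of_int (dominant n) + rho (k1, k2)) (k1, k2))"
proof -
  define a b where "a = nat (k1 + k2)" "b = nat k2"
  have k: "k1 = int a - int b" "k2 = int b" and ab: "1 \<le> b" "b \<le> a" "1 \<le> a"
    using assms by (auto simp: a_b_def)
  have rho: "rho (k1, k2) = (real a + real b) / 2"
    by (simp add: rho_def k)
  define j where "j = basis_position n"
  define w where "w = weyl_upper n * weyl_lower (dominant n)"
  have "nonsym_jacobi n (k1, k2) = jacobi_poly a b j"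
    unfolding nonsym_jacobi_def k j_def by (rule jacobi_gs_eq_jacobi_poly[OF ab(1,2)])
  then have "jacobi_norm_sq (k1, k2) (nonsym_jacobi n (k1, k2)) = of_real (jacobi_poly_norm a b j)"
    using jacobi_form_jacobi_poly[OF ab(3,1)] jacobi_inner_eq_form[OF real_coeffs_jacobi_poly ab(2)]
    by (simp add: jacobi_norm_sq_def k)
  also have "jacobi_poly_norm a b j = c_quotient w k1 k2 (real_of_int (dominant n) + rho (k1, k2))"
  proof (cases "n > 0")
    case True
    define m where "m = nat (n - 1)"
    have "j = 2 * m + 1" "w = Weyl_1" "real_of_int (dominant n) = real m + 1"
      using True by (auto simp: j_def m_def basis_position_def w_def weyl_upper_def weyl_lower_def
          dominant_def times_weyl_def one_weyl_def)
    then show ?thesis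
      using jacobi_poly_norm_eq_c_quotient(2)[OF ab(1), of a m] by (simp only: k rho[unfolded k])
  next
    case False
    define m where "m = nat (- n)"
    have "j = 2 * m" "w = Weyl_s" "real_of_int (dominant n) = real m"
      using False by (auto simp: j_def m_def basis_position_def w_def weyl_upper_def weyl_lower_def
          dominant_def times_weyl_def one_weyl_def)
    then show ?thesis
      using jacobi_poly_norm_eq_c_quotient(1)[OF ab(1), of a m] by (simp only: k rho[unfolded k])
  qed
  finally show ?thesis by (simp only: c_quotient_def w_def)
qed

end
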